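(* Let $K\subseteq\mathbb{R}^n$ be a closed set and $h:\mathbb{R}^n\to\mathbb{R}\cup\{\pm\infty\}$ a proper function such that $K\subseteq\operatorname{dom}h$. Suppose that $\overline{x}\in\operatorname{argmin}_K h$ and that $K$ is star-shaped at $\overline{x}$. If $h$ is strongly star quasiconvex on $K$ with modulus $\gamma>0$, then $$h(\overline{x})+\frac{\gamma}{4}\|y-\overline{x}\|^2\le h(y)\quad\text{for all }y\in K.$$
   Context: $h$ is proper if $\operatorname{dom}h:=\{x: h(x)<+\infty\}\ne\emptyset$ and $h>-\infty$ everywhere. $\operatorname{argmin}_K h$ is the set of minimizers of $h$ over $K$. $K$ is star-shaped at $\overline{x}\in K$ if $[\overline{x},x]\subseteq K$ for every $x\in K$. $h$ is strongly star quasiconvex on $K$ with modulus $\gamma>0$ if, with $\overline{x}\in\operatorname{argmin}_K h$ (then unique), for every $y\in K$ and $\lambda\in[0,1]$, $$h(\lambda\overline{x}+(1-\lambda)y)\le h(y)-\lambda(1-\lambda)\frac{\gamma}{2}\|y-\overline{x}\|^2.$$ *)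

theory Defs
  imports "HOL-Analysis.Analysis"
begin

definition effective_domain :: "('a \<Rightarrow> ereal) \<Rightarrow> 'a set" where
  "effective_domain h = {x. h x < \<infinity>}"

definition proper_fun :: "('a \<Rightarrow> ereal) \<Rightarrow> bool" where
  "proper_fun h \<longleftrightarrow> effective_domain h \<noteq> {} \<and> (\<forall>x. h x > -\<infinity>)"

definition argmin_on :: "'a set \<Rightarrow> ('a \<Rightarrow> ereal) \<Rightarrow> 'a set" where
  "argmin_on K h = {x. is_arg_min h (\<lambda>z. z \<in> K) x}"

text \<open>The library predicate \<^const>\<open>starlike\<close> existentially quantifies the centre.\<close>

definition starlike_at :: "'a::real_vector set \<Rightarrow> 'a \<Rightarrow> bool" where
  "starlike_at K a \<longleftrightarrow> a \<in> K \<and> (\<forall>x\<in>K. closed_segment a x \<subseteq> K)"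

text \<open>
  The reference minimizer is quantified existentially. If \<open>K\<close> is star-shaped at some
  minimizer, the inequality forces the minimizer to be unique (take the midpoint with another
  one), so the choice of witness is then immaterial.
\<close>

definition strongly_star_quasiconvex_on ::
    "'a::real_normed_vector set \<Rightarrow> ('a \<Rightarrow> ereal) \<Rightarrow> real \<Rightarrow> bool" where
  "strongly_star_quasiconvex_on K h \<gamma> \<longleftrightarrow>
     \<gamma> > 0 \<and>
     (\<exists>xbar\<in>argmin_on K h. \<forall>y\<in>K. \<forall>t\<in>{0..1::real}.
        h (t *\<^sub>R xbar + (1 - t) *\<^sub>R y)
          \<le> h y - ereal (t * (1 - t) * (\<gamma> / 2) * (norm (y - xbar))\<^sup>2))"

end

theory Submission
  imports Defs
begin

text \<open>
  Restricting \<open>h\<close> to the segment from the minimizer to \<open>y\<close> reduces the claim to one dimension.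
  A single step of the defining inequality only yields the constant \<open>\<gamma>/8\<close>. Contracting
  repeatedly by a factor \<open>s < 1\<close> and summing the geometric series of the gains
  \<open>s (1 - s) (\<gamma>/2) s\<^bsup>2k\<^esup>\<close> yields \<open>s / (1 + s) * (\<gamma>/2)\<close>, which tends to \<open>\<gamma>/4\<close> as
  \<open>s\<close> tends to \<open>1\<close>.
\<close>

lemma quadratic_growth_iterate:
  fixes f :: "real \<Rightarrow> real"
  assumes step: "\<And>r s. r \<in> {0..1} \<Longrightarrow> s \<in> {0..1} \<Longrightarrow> f (s * r) \<le> f r - s * (1 - s) * c * r\<^sup>2"
    and s: "0 \<le> s" "s < 1"
  shows "f (s ^ n) + s / (1 + s) * (1 - s ^ (2 * n)) * c \<le> f 1"
proof (induction n)
  case 0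
  show ?case by simp
next
  case (Suc n)
  \<comment> \<open>The increment of the partial sum telescopes:
    \<open>s ^ (2 * n) - s ^ (2 * Suc n)\<close> equals
    \<open>(1 - s) * (1 + s) * s ^ (2 * n)\<close>, and the factor \<open>1 + s\<close>
    cancels.\<close>
  have gain: "s / (1 + s) * (1 - s ^ (2 * Suc n)) * c
      = s / (1 + s) * (1 - s ^ (2 * n)) * c + s * (1 - s) * c * (s ^ n)\<^sup>2"
  proof -
    have "s ^ (2 * Suc n) = s\<^sup>2 * (s ^ n)\<^sup>2" "s ^ (2 * n) = (s ^ n)\<^sup>2"
      by (simp_all only: power_even_eq power_Suc power_mult_distrib)
    then show ?thesis
      using s by (simp add: divide_simps) (simp add: algebra_simps power2_eq_square)
  qed
  have "f (s ^ Suc n) \<le> f (s ^ n) - s * (1 - s) * c * (s ^ n)\<^sup>2"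
    using step[of "s ^ n" s] s by (simp add: power_le_one)
  with Suc gain show ?case by linarith
qed

text \<open>The order of the limits matters: first \<open>n\<close> grows at fixed
  \<open>s < 1\<close>, then \<open>s\<close> tends to 1. At fixed \<open>n\<close> the gain would
  vanish as \<open>s\<close> tends to 1.\<close>

lemma quadratic_growth_on_unit_interval:
  fixes f :: "real \<Rightarrow> real"
  assumes step: "\<And>r s. r \<in> {0..1} \<Longrightarrow> s \<in> {0..1} \<Longrightarrow> f (s * r) \<le> f r - s * (1 - s) * c * r\<^sup>2"
  shows "f 0 + c / 2 \<le> f 1"
proof -
  have bound: "f 0 + s / (1 + s) * c \<le> f 1" if s: "0 \<le> s" "s < 1" for s
  proof (rule LIMSEQ_le_const2)
    have "s\<^sup>2 < 1"
      using s by (simp add: abs_square_less_1)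
    then show "(\<lambda>n. f 0 + s / (1 + s) * (1 - (s\<^sup>2) ^ n) * c) \<longlonglongrightarrow> f 0 + s / (1 + s) * c"
      using s by (auto intro!: tendsto_eq_intros)
    \<comment> \<open>Contraction by the factor 0 gives \<open>f 0 \<le> f (s ^ n)\<close>, so no
      continuity of \<open>f\<close> at 0 is needed.\<close>
    have "f 0 + s / (1 + s) * (1 - (s\<^sup>2) ^ n) * c \<le> f 1" for n
      using quadratic_growth_iterate[of f c s n] step[of "s ^ n" 0] s
      by (simp add: step power_le_one power_mult)
    then show "\<exists>N. \<forall>n\<ge>N. f 0 + s / (1 + s) * (1 - (s\<^sup>2) ^ n) * c \<le> f 1"
      by blast
  qed
  show ?thesis
  proof (rule tendsto_upperbound)
    show "((\<lambda>s. f 0 + s / (1 + s) * c) \<longlongrightarrow> f 0 + c / 2) (at_left 1)"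
      by (auto intro!: tendsto_eq_intros)
    show "\<forall>\<^sub>F s in at_left 1. f 0 + s / (1 + s) * c \<le> f 1"
      using eventually_at_left_real[of 0 "1::real"] by (rule eventually_mono) (use bound in auto)
  qed simp
qed

lemma argmin_onD:
  fixes h :: "'a \<Rightarrow> ereal"
  assumes "x \<in> argmin_on K h"
  shows "x \<in> K" "y \<in> K \<Longrightarrow> h x \<le> h y"
  using assms by (auto simp: argmin_on_def is_arg_min_linorder)

lemma starlike_atD:
  assumes "starlike_at K a" "x \<in> K" "t \<in> {0..1}"
  shows "t *\<^sub>R a + (1 - t) *\<^sub>R x \<in> K"
proof -
  have "t *\<^sub>R a + (1 - t) *\<^sub>R x \<in> closed_segment a x"
    unfolding in_segment using assms(3) by (intro exI[of _ "1 - t"]) auto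
  then show ?thesis
    using assms(1,2) by (auto simp: starlike_at_def)
qed

lemma proper_fun_finite:
  assumes "proper_fun h" "K \<subseteq> effective_domain h" "x \<in> K"
  shows "h x = ereal (real_of_ereal (h x))"
proof -
  have "h x < \<infinity>" "h x > -\<infinity>"
    using assms by (auto simp: proper_fun_def effective_domain_def)
  then show ?thesis by (cases "h x") auto
qed

text \<open>The definition speaks of some minimizer; this transfers its inequality to the given
  \<open>xbar\<close>, by showing that the two coincide.\<close>

lemma strongly_star_quasiconvex_at_minimizer:
  assumes proper: "proper_fun h" "K \<subseteq> effective_domain h"
    and min: "xbar \<in> argmin_on K h" and star: "starlike_at K xbar"
    and convex: "strongly_star_quasiconvex_on K h \<gamma>"
    and y: "y \<in> K" and t: "t \<in> {0..1}"
  shows "h (t *\<^sub>R xbar + (1 - t) *\<^sub>R y)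
           \<le> h y - ereal (t * (1 - t) * (\<gamma> / 2) * (norm (y - xbar))\<^sup>2)"
proof -
  from convex obtain x where \<gamma>: "\<gamma> > 0" and x: "x \<in> argmin_on K h"
    and ineq: "\<And>y t. y \<in> K \<Longrightarrow> t \<in> {0..1} \<Longrightarrow>
      h (t *\<^sub>R x + (1 - t) *\<^sub>R y) \<le> h y - ereal (t * (1 - t) * (\<gamma> / 2) * (norm (y - x))\<^sup>2)"
    unfolding strongly_star_quasiconvex_on_def by blast
  \<comment> \<open>At the midpoint the inequality centred at \<open>x\<close> gains
    \<open>1/2 * 1/2 * \<gamma>/2 = \<gamma>/8\<close> times the squared distance below the minimum
    \<open>h xbar\<close>, so that distance is zero.\<close>
  define m where "m = (1/2) *\<^sub>R x + (1/2) *\<^sub>R xbar"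
  have "m \<in> K"
    using starlike_atD[OF star argmin_onD(1)[OF x], of "1/2"] by (simp add: m_def add.commute)
  then have "h xbar \<le> h m"
    by (rule argmin_onD(2)[OF min])
  also have "h m \<le> h xbar - ereal (\<gamma> / 8 * (norm (xbar - x))\<^sup>2)"
    using ineq[OF argmin_onD(1)[OF min], of "1/2"] by (simp add: m_def)
  finally have "\<gamma> / 8 * (norm (xbar - x))\<^sup>2 \<le> 0"
    \<comment> \<open>Cancelling \<open>h xbar\<close> in \<open>ereal\<close> requires that it be
      finite.\<close>
    by (subst (asm) (1 2) proper_fun_finite[OF proper argmin_onD(1)[OF min]]) simp
  with \<gamma> have "x = xbar"
    by (auto simp: mult_le_0_iff)
  with ineq y t show ?thesis by blast
qed

theorem proposition17:
  fixes K :: "(real ^ 'n) set" and h :: "real ^ 'n \<Rightarrow> ereal"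
    and xbar :: "real ^ 'n" and \<gamma> :: real
  assumes "closed K"
    and "proper_fun h"
    and "K \<subseteq> effective_domain h"
    and "xbar \<in> argmin_on K h"
    and "starlike_at K xbar"
    and "\<gamma> > 0"
    and "strongly_star_quasiconvex_on K h \<gamma>"
  shows "\<forall>y\<in>K. h xbar + ereal (\<gamma> / 4 * (norm (y - xbar))\<^sup>2) \<le> h y"
proof
  fix y assume y: "y \<in> K"
  \<comment> \<open>With \<open>p 0 = xbar\<close> and \<open>p 1 = y\<close>, contraction towards
    \<open>xbar\<close> by \<open>s\<close> is multiplication of the parameter by
    \<open>s\<close>.\<close>
  define p where "p r = (1 - r) *\<^sub>R xbar + r *\<^sub>R y" for r
  define f where "f r = real_of_ereal (h (p r))" for r
  have pK: "p r \<in> K" if "r \<in> {0..1}" for r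
    using starlike_atD[OF assms(5) y, of "1 - r"] that by (simp add: p_def)
  have hp: "h (p r) = ereal (f r)" if "r \<in> {0..1}" for r
    unfolding f_def using proper_fun_finite[OF assms(2,3) pK[OF that]] .
  have "f (s * r) \<le> f r - s * (1 - s) * (\<gamma> / 2 * (norm (y - xbar))\<^sup>2) * r\<^sup>2"
    if r: "r \<in> {0..1}" and s: "s \<in> {0..1}" for r s
  proof -
    have comb: "(1 - s) *\<^sub>R xbar + s *\<^sub>R p r = p (s * r)"
      by (simp add: p_def algebra_simps)
    have "p r - xbar = r *\<^sub>R (y - xbar)"
      by (simp add: p_def algebra_simps)
    then have norm: "(norm (p r - xbar))\<^sup>2 = (norm (y - xbar))\<^sup>2 * r\<^sup>2"
      by (simp add: power_mult_distrib)
    have "s * r \<in> {0..1}"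
      using r s by (auto intro: mult_le_one)
    \<comment> \<open>The definition puts the weight \<open>t\<close> on the minimizer, hence
      \<open>t = 1 - s\<close>.\<close>
    then show ?thesis
      using strongly_star_quasiconvex_at_minimizer[OF assms(2-5,7) pK[OF r], of "1 - s"] s
      by (simp add: comb norm hp[OF r] hp[of "s * r"] mult.assoc mult.left_commute)
  qed
  then have "f 0 + (\<gamma> / 2 * (norm (y - xbar))\<^sup>2) / 2 \<le> f 1"
    by (rule quadratic_growth_on_unit_interval)
  then show "h xbar + ereal (\<gamma> / 4 * (norm (y - xbar))\<^sup>2) \<le> h y"
    using hp[of 0] hp[of 1] by (simp add: p_def)
qed

end
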